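(* Let $\varepsilon,s,t,N,M>0$ satisfy $\varepsilon\le 1/10$, $8s\le \varepsilon t$, $1/\varepsilon^2\le s$ and $M\ge (1+100\varepsilon)N$. Let $\mathcal{H}$ be a $3$-uniform hypergraph on $M$ vertices which admits a rooting function $f$ such that $\mathcal{H}$ (with respect to $f$) is $(\varepsilon,N,s,t)$-nice. Then there exists a family $\mathcal{C}\subseteq\mathcal{P}(V(\mathcal{H}))$ such that: (1) for every independent set $I\subseteq V(\mathcal{H})$ there is $C_I\in\mathcal{C}$ with $I\subseteq C_I$; (2) $\log_2|\mathcal{C}|\le \frac{2M}{\varepsilon}\left(H(2s/t)+H\left(\frac{1}{4\varepsilon s}\right)\right)$; (3) every $C\in\mathcal{C}$ satisfies $|C|\le (1+100\varepsilon)N$.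
   Context: $H(p)=-p\log_2 p-(1-p)\log_2(1-p)$ is the binary entropy function on $[0,1]$. An independent set in $\mathcal{H}$ is a vertex set containing no edge of $\mathcal{H}$. A rooting function for a $3$-uniform hypergraph $\mathcal{H}$ is a function $f:E(\mathcal{H})\to V(\mathcal{H})$ such that $f(e)\in e$ for every edge $e$, and for any two vertices $u,v$ there is at most one edge $e$ with $u,v\in e$ and $f(e)\notin\{u,v\}$; $f(e)$ is called the head of $e$. For $A\subseteq V(\mathcal{H})$ and $v\in A$, the head link graph $\mathrm{HL}_v(\mathcal{H}\cap A)$ is the graph on vertex set $A$ whose edges are the pairs $\{u_1,u_2\}\subseteq A$ such that $\{v,u_1,u_2\}\in E(\mathcal{H})$ and $f(\{v,u_1,u_2\})=v$. A vertex $v\in A$ is $(A,s,t)$-eligible if $\mathrm{HL}_v(\mathcal{H}\cap A)$ has a subgraph $G_v$ with maximum degree $\Delta(G_v)\le s$ and at least $t$ edges. $\mathcal{H}$ is $(\varepsilon,N,s,t)$-nice if every $A\subseteq V(\mathcal{H})$ with $|A|\ge(1+\varepsilon)N$ contains an $(A,s,t)$-eligible vertex. *)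

theory Defs
  imports Complex_Main
begin

text \<open>At the endpoints this has the usual value 0, since \<open>0 * log 2 0 = 0\<close>.\<close>

definition binary_entropy :: "real \<Rightarrow> real" where
  "binary_entropy p = - p * log 2 p - (1 - p) * log 2 (1 - p)"

definition three_uniform_hypergraph :: "'a set \<Rightarrow> 'a set set \<Rightarrow> bool" where
  "three_uniform_hypergraph V E \<longleftrightarrow> finite V \<and> (\<forall>e\<in>E. e \<subseteq> V \<and> card e = 3)"

definition independent_set :: "'a set \<Rightarrow> 'a set set \<Rightarrow> 'a set \<Rightarrow> bool" where
  "independent_set V E I \<longleftrightarrow> I \<subseteq> V \<and> \<not> (\<exists>e\<in>E. e \<subseteq> I)"

text \<open>Only the values of \<open>f\<close> on \<open>E\<close> are relevant.\<close>

definition rooting_function :: "'a set \<Rightarrow> 'a set set \<Rightarrow> ('a set \<Rightarrow> 'a) \<Rightarrow> bool" where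
  "rooting_function V E f \<longleftrightarrow>
     (\<forall>e\<in>E. f e \<in> e) \<and>
     (\<forall>u\<in>V. \<forall>v\<in>V. u \<noteq> v \<longrightarrow>
        (\<exists>\<^sub>\<le>\<^sub>1 e. e \<in> E \<and> u \<in> e \<and> v \<in> e \<and> f e \<notin> {u, v}))"

text \<open>
  A graph is a pair of a vertex set and a set of edges, each edge being the set of its two
  endpoints. In \<open>head_link\<close> the vertices \<open>v\<close>, \<open>u1\<close>, \<open>u2\<close> are pairwise distinct whenever
  all members of \<open>E\<close> have three elements.
\<close>

definition head_link :: "'a set set \<Rightarrow> ('a set \<Rightarrow> 'a) \<Rightarrow> 'a set \<Rightarrow> 'a \<Rightarrow> 'a set \<times> 'a set set" where
  "head_link E f A v =
     (A, {{u1, u2} | u1 u2. {u1, u2} \<subseteq> A \<and> {v, u1, u2} \<in> E \<and> f {v, u1, u2} = v})"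

definition subgraph :: "'a set \<times> 'a set set \<Rightarrow> 'a set \<times> 'a set set \<Rightarrow> bool" where
  "subgraph G G' \<longleftrightarrow> fst G \<subseteq> fst G' \<and> snd G \<subseteq> snd G' \<and> (\<forall>e\<in>snd G. e \<subseteq> fst G)"

definition degree :: "'a set \<times> 'a set set \<Rightarrow> 'a \<Rightarrow> nat" where
  "degree G u = card {e \<in> snd G. u \<in> e}"

text \<open>The inserted 0 only fixes the value for the graph without vertices.\<close>

definition max_degree :: "'a set \<times> 'a set set \<Rightarrow> nat" where
  "max_degree G = Max (insert 0 (degree G ` fst G))"

definition eligible ::
    "'a set set \<Rightarrow> ('a set \<Rightarrow> 'a) \<Rightarrow> 'a set \<Rightarrow> real \<Rightarrow> real \<Rightarrow> 'a \<Rightarrow> bool" where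
  "eligible E f A s t v \<longleftrightarrow>
     v \<in> A \<and>
     (\<exists>G. subgraph G (head_link E f A v) \<and>
          real (max_degree G) \<le> s \<and> real (card (snd G)) \<ge> t)"

definition nice ::
    "'a set \<Rightarrow> 'a set set \<Rightarrow> ('a set \<Rightarrow> 'a) \<Rightarrow> real \<Rightarrow> real \<Rightarrow> real \<Rightarrow> real \<Rightarrow> bool" where
  "nice V E f \<epsilon> N s t \<longleftrightarrow>
     (\<forall>A. A \<subseteq> V \<and> real (card A) \<ge> (1 + \<epsilon>) * N \<longrightarrow> (\<exists>v\<in>A. eligible E f A s t v))"

end

theory Submission
  imports Defs
begin

text \<open>
  One round turns a set \<open>A\<close> of \<open>n > (1 + 100\<epsilon>)N\<close> vertices into few subsets of size at most
  \<open>(1 - \<epsilon>/2)n\<close> covering its independent subsets \<open>I\<close>. First query, one after the other, vertices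
  \<open>v\<close> that are eligible in the set of all vertices that are neither queried nor saturated. If
  \<open>v \<in> I\<close>, then \<open>I\<close> is independent in \<open>G\<^sub>v\<close>, and \<open>G\<^sub>v\<close> is added to an auxiliary graph \<open>R\<close>; a vertex
  is saturated once its degree in \<open>R\<close> exceeds \<open>s\<close>. Thus \<open>R\<close> has maximum degree at most \<open>2s\<close>, and
  since the graphs \<open>G\<^sub>v\<close> are edge-disjoint (by the rooting property) and have \<open>t\<close> edges, at most
  \<open>2sn/t\<close> answers are positive. Then run the graph container algorithm on \<open>R\<close>, querying vertices
  of degree at least \<open>4\<epsilon>s\<close>; here at most \<open>n/(4\<epsilon>s)\<close> answers are positive. If fewer than \<open>\<epsilon>n/2\<close>
  vertices were discarded overall, then \<open>R\<close> would have at most \<open>6\<epsilon>sn\<close> ordered adjacent pairs, although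
  niceness forces more than \<open>8\<epsilon>n\<close> vertices to be saturated.

  The number of leaves of a decision tree with at most \<open>n\<close> queries and at most \<open>k\<close> positive answers
  obeys Pascal's recurrence for \<open>\<Sum>i\<le>k. n choose i\<close>. Iterating the rounds gives the geometric series
  \<open>\<Sum>i. M(1 - \<epsilon>/2)\<^sup>i = 2M/\<epsilon>\<close>.
\<close>

section \<open>Partial sums of binomial coefficients\<close>

definition binomial_sum :: "nat \<Rightarrow> nat \<Rightarrow> nat" where
  "binomial_sum n k = (\<Sum>i\<le>k. n choose i)"

lemma binomial_sum_pos: "binomial_sum n k \<ge> 1"
proof -
  have "(\<Sum>i\<le>0. n choose i) \<le> (\<Sum>i\<le>k. n choose i)"
    by (rule sum_mono2) auto
  then show ?thesis by (simp add: binomial_sum_def)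
qed

lemma binomial_sum_Suc_Suc:
  "binomial_sum (Suc n) (Suc k) = binomial_sum n (Suc k) + binomial_sum n k"
  unfolding binomial_sum_def by (simp only: sum.atMost_Suc_shift) (simp add: sum.distrib)

text \<open>The binomial distribution with parameter \<open>p\<close> has total mass 1. Since
  \<open>p \<le> 1 - p\<close>, each weight \<open>p ^ i * (1 - p) ^ (n - i)\<close> with
  \<open>i \<le> k \<le> p * n\<close> is at least the value of this expression at
  \<open>i = p * n\<close>, which is 2 to the power -nH(p).\<close>

lemma binomial_sum_le_entropy:
  fixes p :: real
  assumes p: "0 < p" "p \<le> 1/2" and k: "real k \<le> p * real n"
  shows "real (binomial_sum n k) \<le> 2 powr (real n * binary_entropy p)"
proof -
  define w where "w = 2 powr (- (real n * binary_entropy p))"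
  have w_exp: "w = exp (p * n * ln p + (1 - p) * n * ln (1 - p))"
  proof -
    have "ln 2 * - (real n * binary_entropy p) = p * n * ln p + (1 - p) * n * ln (1 - p)"
      by (simp add: binary_entropy_def log_def field_simps)
    then show ?thesis by (simp add: w_def powr_def mult.commute)
  qed
  have "k \<le> n"
  proof -
    have "p * real n \<le> 1 * real n" using p by (intro mult_right_mono) auto
    then show ?thesis using k by simp
  qed
  have bound: "w \<le> p ^ i * (1 - p) ^ (n - i)" if "i \<le> k" for i
  proof -
    have i: "i \<le> n" "real i \<le> p * n" using that \<open>k \<le> n\<close> k by auto
    have "ln p \<le> ln (1 - p)" using p by simp
    \<comment> \<open>The product is exactly the difference of the two exponents compared
      next.\<close>
    then have "0 \<le> (p * n - i) * (ln (1 - p) - ln p)" using i by simp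
    then have le: "p * n * ln p + (1 - p) * n * ln (1 - p) \<le> real i * ln p + real (n - i) * ln (1 - p)"
      using i by (simp add: of_nat_diff algebra_simps)
    have "p ^ i * (1 - p) ^ (n - i) = exp (real i * ln p + real (n - i) * ln (1 - p))"
      using p by (simp add: exp_add exp_of_nat_mult)
    then show ?thesis using le by (simp add: w_exp)
  qed
  have "real (binomial_sum n k) * w = (\<Sum>i\<le>k. real (n choose i) * w)"
    by (simp add: binomial_sum_def sum_distrib_right)
  also have "\<dots> \<le> (\<Sum>i\<le>k. real (n choose i) * (p ^ i * (1 - p) ^ (n - i)))"
    using bound by (intro sum_mono mult_left_mono) auto
  also have "\<dots> \<le> (\<Sum>i\<le>n. real (n choose i) * (p ^ i * (1 - p) ^ (n - i)))"
    using \<open>k \<le> n\<close> p by (intro sum_mono2) auto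
  also have "\<dots> = (p + (1 - p)) ^ n"
    by (subst binomial_ring) (simp add: mult.assoc)
  finally have "real (binomial_sum n k) * w \<le> 1" by simp
  then show ?thesis by (simp add: w_def powr_minus field_simps)
qed

section \<open>Graphs as symmetric relations\<close>

text \<open>For a symmetric relation this is the degree sum: \<open>card R\<close> counts ordered
  pairs, not edges.\<close>

lemma card_rel_eq_sum:
  assumes "finite A" "R \<subseteq> A \<times> A"
  shows "card R = (\<Sum>x\<in>A. card (R `` {x}))"
proof -
  have "R = Sigma A (\<lambda>x. R `` {x})" using assms by auto
  moreover have "finite (R `` {x})" for x
    using assms by (meson finite_Image finite_SigmaI finite_subset)
  ultimately show ?thesis using assms by (metis card_SigmaI)
qed

lemma card_rel_le:
  fixes c :: real
  assumes "finite A" "R \<subseteq> A \<times> A" "\<And>x. x \<in> A \<Longrightarrow> real (card (R `` {x})) \<le> c"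
  shows "real (card R) \<le> real (card A) * c"
  using assms sum_bounded_above[of A "\<lambda>x. real (card (R `` {x}))" c]
  by (simp add: card_rel_eq_sum)

definition rel_independent :: "('a \<times> 'a) set \<Rightarrow> 'a set \<Rightarrow> bool" where
  "rel_independent R I \<longleftrightarrow> (\<forall>(x, y)\<in>R. \<not> (x \<in> I \<and> y \<in> I))"

text \<open>\<open>R\<close> consists of the ordered adjacent pairs of the graph witnessing
  eligibility, so its images of points are neighbourhoods. Mapping pairs onto edges gives
  \<open>card R \<ge> t\<close>; counting both orders would give \<open>2 * t\<close>, but
  \<open>t\<close> is what leads to the ratio \<open>2 * s / t\<close>.\<close>

lemma eligible_imp_rel:
  assumes V: "three_uniform_hypergraph V E" and A: "A \<subseteq> V" and el: "eligible E f A s t v"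
    and s: "0 < s"
  obtains R where "R \<subseteq> A \<times> A" "sym R" "\<And>x. real (card (R `` {x})) \<le> s" "real (card R) \<ge> t"
    "\<And>x y. (x, y) \<in> R \<Longrightarrow> {v, x, y} \<in> E \<and> f {v, x, y} = v"
proof -
  obtain G where sub: "subgraph G (head_link E f A v)" and maxd: "real (max_degree G) \<le> s"
    and cardG: "real (card (snd G)) \<ge> t"
    using el unfolding eligible_def by blast
  have finA: "finite A" using V A finite_subset unfolding three_uniform_hypergraph_def by blast
  define R where "R = {(x, y). {x, y} \<in> snd G}"
  have edge: "{x, y} \<subseteq> A \<and> {v, x, y} \<in> E \<and> f {v, x, y} = v" if "{x, y} \<in> snd G" for x y
  proof -
    have "{x, y} \<in> snd (head_link E f A v)" using that sub unfolding subgraph_def by blast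
    then obtain u1 u2 where u: "{x, y} = {u1, u2}" "{u1, u2} \<subseteq> A" "{v, u1, u2} \<in> E"
      "f {v, u1, u2} = v"
      unfolding head_link_def by auto
    from u(1) have "{v, x, y} = {v, u1, u2}" by auto
    then show ?thesis using u by metis
  qed
  have fstG: "finite (fst G)" and sndG: "\<forall>e\<in>snd G. e \<subseteq> fst G"
    using sub finA finite_subset unfolding subgraph_def head_link_def by auto
  then have fins: "finite (snd G)" by (meson Pow_iff finite_Pow_iff finite_subset subsetI)
  have subR: "R \<subseteq> A \<times> A" using edge unfolding R_def by auto
  have "sym R" unfolding R_def sym_def by (auto simp: insert_commute)
  have deg: "real (card (R `` {x})) \<le> s" for x
  proof (cases "x \<in> fst G")
    case True
    have "card (R `` {x}) \<le> degree G x"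
    proof -
      have "inj_on (\<lambda>y. {x, y}) (R `` {x})" by (auto simp: inj_on_def doubleton_eq_iff)
      moreover have "(\<lambda>y. {x, y}) ` (R `` {x}) \<subseteq> {e \<in> snd G. x \<in> e}" unfolding R_def by auto
      ultimately show ?thesis unfolding degree_def using fins by (intro card_inj_on_le) auto
    qed
    also have "\<dots> \<le> max_degree G" unfolding max_degree_def using True fstG by (intro Max_ge) auto
    finally show ?thesis using maxd by linarith
  next
    case False
    then have "R `` {x} = {}" using sndG unfolding R_def by auto
    then show ?thesis using s by simp
  qed
  have "snd G \<subseteq> (\<lambda>(x, y). {x, y}) ` R"
  proof
    fix e assume e: "e \<in> snd G"
    then have "e \<in> snd (head_link E f A v)" using sub unfolding subgraph_def by blast
    then obtain u1 u2 where "e = {u1, u2}" unfolding head_link_def by auto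
    then show "e \<in> (\<lambda>(x, y). {x, y}) ` R" using e unfolding R_def by force
  qed
  moreover have finR: "finite R" using subR finA by (meson finite_SigmaI finite_subset)
  ultimately have "card (snd G) \<le> card R" by (meson card_image_le card_mono finite_imageI le_trans)
  then have "real (card R) \<ge> t" using cardG by linarith
  then show ?thesis using that[OF subR \<open>sym R\<close> deg] edge unfolding R_def by auto
qed

section \<open>The graph container algorithm\<close>

text \<open>Here \<open>m\<close> bounds the queries still possible and \<open>k\<close> the
  positive answers: each positive answer deletes at least \<open>d\<close> vertices from
  \<open>C\<close>, and either answer removes the queried vertex from the set of high-degree
  vertices.\<close>

lemma graph_containers:
  fixes d :: real
  assumes "0 < d" "finite C"
    and "card {u \<in> C. d \<le> real (card (R `` {u} \<inter> C))} \<le> m"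
    and "real (card C) < (real k + 1) * d"
  shows "\<exists>F. F \<subseteq> Pow C \<and> card F \<le> binomial_sum m k \<and>
           (\<forall>C'\<in>F. \<forall>u\<in>C'. real (card (R `` {u} \<inter> C')) < d) \<and>
           (\<forall>I\<subseteq>C. rel_independent R I \<longrightarrow> (\<exists>C'\<in>F. I \<subseteq> C'))"
  using assms(2-)
proof (induction m arbitrary: C k)
  case 0
  then have "{u \<in> C. d \<le> real (card (R `` {u} \<inter> C))} = {}" by simp
  then have "\<forall>u\<in>C. real (card (R `` {u} \<inter> C)) < d" by (auto simp: not_le)
  then show ?case using binomial_sum_pos by (intro exI[of _ "{C}"]) auto
next
  case (Suc m)
  let ?Q = "\<lambda>C. {u \<in> C. d \<le> real (card (R `` {u} \<inter> C))}"
  show ?case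
  proof (cases "?Q C = {}")
    case True
    then have "\<forall>u\<in>C. real (card (R `` {u} \<inter> C)) < d" by (auto simp: not_le)
    then show ?thesis using binomial_sum_pos by (intro exI[of _ "{C}"]) auto
  next
    case False
    then obtain u where u: "u \<in> C" "d \<le> real (card (R `` {u} \<inter> C))" by auto
    \<comment> \<open>Degrees inside \<open>C\<close> only fall when \<open>C\<close> shrinks, so no
      vertex newly reaches degree \<open>d\<close>.\<close>
    have Qmono: "card (?Q C') \<le> m" if "C' \<subseteq> C" "u \<notin> ?Q C'" for C'
    proof -
      have "?Q C' \<subseteq> ?Q C - {u}"
      proof
        fix x assume x: "x \<in> ?Q C'"
        have "card (R `` {x} \<inter> C') \<le> card (R `` {x} \<inter> C)"
          using \<open>C' \<subseteq> C\<close> Suc.prems(1) by (intro card_mono) auto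
        then have "d \<le> real (card (R `` {x} \<inter> C))" using x by force
        then show "x \<in> ?Q C - {u}" using x that by auto
      qed
      then have "card (?Q C') \<le> card (?Q C - {u})"
        using Suc.prems(1) by (intro card_mono) auto
      also have "\<dots> = card (?Q C) - 1" using u by (intro card_Diff_singleton) auto
      also have "\<dots> \<le> m" using Suc.prems(2) by linarith
      finally show ?thesis .
    qed
    have "card (R `` {u} \<inter> C) \<le> card C" using Suc.prems(1) by (intro card_mono) auto
    \<comment> \<open>Together with \<open>card C < (k + 1) * d\<close> this excludes
      \<open>k = 0\<close>, so a positive answer is still within budget.\<close>
    then have "d \<le> real (card C)" using u by linarith
    with Suc.prems(3) have "0 < real k * d" by (simp add: algebra_simps)
    then obtain l where k: "k = Suc l" by (cases k) auto
    define C1 where "C1 = C - {u}"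
    define C2 where "C2 = C - R `` {u}"
    have "card C1 \<le> card C" unfolding C1_def using Suc.prems(1) by (intro card_mono) auto
    then have "real (card C1) < (real k + 1) * d" using Suc.prems(3) by linarith
    moreover have "card (?Q C1) \<le> m" by (rule Qmono) (auto simp: C1_def)
    ultimately obtain F1 where F1: "F1 \<subseteq> Pow C1" "card F1 \<le> binomial_sum m k"
      "\<forall>C'\<in>F1. \<forall>u\<in>C'. real (card (R `` {u} \<inter> C')) < d"
      "\<forall>I\<subseteq>C1. rel_independent R I \<longrightarrow> (\<exists>C'\<in>F1. I \<subseteq> C')"
      using Suc.IH[of C1 k] Suc.prems(1) unfolding C1_def by auto
    have "card C2 = card C - card (R `` {u} \<inter> C)"
      unfolding C2_def using card_Diff_subset_Int[of C "R `` {u}"] Suc.prems(1)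
      by (simp add: Int_commute)
    then have "real (card C2) = real (card C) - real (card (R `` {u} \<inter> C))"
      using \<open>card (R `` {u} \<inter> C) \<le> card C\<close> by (simp add: of_nat_diff)
    then have "real (card C2) < (real l + 1) * d"
      using u Suc.prems(3) k by (simp add: algebra_simps)
    moreover have "card (?Q C2) \<le> m"
    proof (rule Qmono)
      \<comment> \<open>A positive answer may keep \<open>u\<close> in \<open>C2\<close>, but all
        its neighbours are gone and its degree 0 is below \<open>d\<close>.\<close>
      have "R `` {u} \<inter> C2 = {}" unfolding C2_def by auto
      then show "u \<notin> ?Q C2" using \<open>0 < d\<close> by simp
    qed (auto simp: C2_def)
    ultimately obtain F2 where F2: "F2 \<subseteq> Pow C2" "card F2 \<le> binomial_sum m l"
      "\<forall>C'\<in>F2. \<forall>u\<in>C'. real (card (R `` {u} \<inter> C')) < d"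
      "\<forall>I\<subseteq>C2. rel_independent R I \<longrightarrow> (\<exists>C'\<in>F2. I \<subseteq> C')"
      using Suc.IH[of C2 l] Suc.prems(1) unfolding C2_def by auto
    have "card (F1 \<union> F2) \<le> binomial_sum (Suc m) k"
      using card_Un_le[of F1 F2] F1(2) F2(2) by (simp add: k binomial_sum_Suc_Suc)
    moreover have "\<exists>C'\<in>F1 \<union> F2. I \<subseteq> C'" if "I \<subseteq> C" "rel_independent R I" for I
    proof (cases "u \<in> I")
      case True
      then have "I \<subseteq> C2" using that unfolding C2_def rel_independent_def by auto
      then show ?thesis using F2(4) that by blast
    next
      case False
      then have "I \<subseteq> C1" using that unfolding C1_def by auto
      then show ?thesis using F1(4) that by blast
    qed
    moreover have "F1 \<union> F2 \<subseteq> Pow C" using F1(1) F2(1) unfolding C1_def C2_def by auto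
    moreover have "\<forall>C'\<in>F1 \<union> F2. \<forall>u\<in>C'. real (card (R `` {u} \<inter> C')) < d"
      using F1(3) F2(3) by blast
    ultimately show ?thesis by (intro exI[of _ "F1 \<union> F2"]) simp
  qed
qed

section \<open>Querying eligible vertices\<close>

definition saturated :: "'a set \<Rightarrow> ('a \<times> 'a) set \<Rightarrow> real \<Rightarrow> 'a set" where
  "saturated A R s = {x \<in> A. s < real (card (R `` {x}))}"

text \<open>
  \<open>P\<close> is the set of queried vertices, \<open>D\<close> contains those with a negative answer, \<open>j\<close> counts the
  positive answers, and \<open>R\<close> is the union of the link graphs of the vertices with a positive answer.
\<close>

definition query_state ::
    "'a set set \<Rightarrow> ('a set \<Rightarrow> 'a) \<Rightarrow> 'a set \<Rightarrow> real \<Rightarrow> real \<Rightarrow>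
      'a set \<Rightarrow> 'a set \<Rightarrow> nat \<Rightarrow> ('a \<times> 'a) set \<Rightarrow> bool" where
  "query_state E f A s t P D j R \<longleftrightarrow>
     P \<subseteq> A \<and> D \<subseteq> P \<and> card P \<le> j + card D \<and>
     R \<subseteq> A \<times> A \<and> sym R \<and> (\<forall>x. real (card (R `` {x})) \<le> 2 * s) \<and>
     real j * t \<le> real (card R) \<and>
     (\<forall>(x, y)\<in>R. \<exists>v\<in>P. {v, x, y} \<in> E \<and> f {v, x, y} = v)"

text \<open>The degree cap \<open>2 * s\<close> bounds \<open>card R\<close> from above, which
  limits the number of positive answers.\<close>

lemma query_state_positive_bound:
  assumes "finite A" "query_state E f A s t P D j R"
  shows "real j * t \<le> 2 * s * real (card A)"
proof -
  have "real (card R) \<le> real (card A) * (2 * s)"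
    using assms unfolding query_state_def by (intro card_rel_le) auto
  then show ?thesis using assms(2) unfolding query_state_def by (simp add: mult.commute)
qed

lemma query_state_no:
  assumes "finite A" "query_state E f A s t P D j R" "v \<in> A - P"
  shows "query_state E f A s t (insert v P) (insert v D) j R"
proof -
  have "P \<subseteq> A" "D \<subseteq> P" using assms unfolding query_state_def by auto
  then have "finite P" "finite D" "v \<notin> D" using assms by (auto intro: finite_subset)
  then have "card (insert v P) \<le> j + card (insert v D)"
    using assms unfolding query_state_def by simp
  then show ?thesis using assms unfolding query_state_def by fastforce
qed

text \<open>The rooting property makes \<open>Rv\<close> disjoint from \<open>R\<close>, so the pair
  counts add. \<open>Rv\<close> touches only unsaturated vertices, whose degree was at most
  \<open>s\<close> and grows by at most \<open>s\<close>, so the cap \<open>2 * s\<close>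
  survives.\<close>

lemma query_state_yes:
  assumes V: "three_uniform_hypergraph V E" and f: "rooting_function V E f"
    and A: "A \<subseteq> V" and fin: "finite A" and st: "query_state E f A s t P D j R"
    and v: "v \<in> A - P" and s: "0 < s"
    and Rv: "Rv \<subseteq> (A - P - saturated A R s) \<times> (A - P - saturated A R s)" "sym Rv"
      "\<And>x. real (card (Rv `` {x})) \<le> s" "real (card Rv) \<ge> t"
      "\<And>x y. (x, y) \<in> Rv \<Longrightarrow> {v, x, y} \<in> E \<and> f {v, x, y} = v"
  shows "query_state E f A s t (insert v P) D (Suc j) (R \<union> Rv)"
proof -
  have "P \<subseteq> A" "R \<subseteq> A \<times> A" using st unfolding query_state_def by auto
  then have finP: "finite P" and finR: "finite R" using fin finite_subset by blast+
  have RvA: "Rv \<subseteq> A \<times> A" using Rv(1) by auto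
  then have finRv: "finite Rv" using fin finite_subset by blast
  have "R \<inter> Rv = {}"
  proof (rule ccontr)
    assume "R \<inter> Rv \<noteq> {}"
    then obtain x y where xy: "(x, y) \<in> R" "(x, y) \<in> Rv" by auto
    then obtain w where w: "w \<in> P" "{w, x, y} \<in> E" "f {w, x, y} = w"
      using st unfolding query_state_def by blast
    have vxy: "{v, x, y} \<in> E" "f {v, x, y} = v" using Rv(5) xy by auto
    \<comment> \<open>By uniformity both heads \<open>v\<close> and \<open>w\<close> lie outside
      \<open>{x, y}\<close>. The rooting property then identifies the two edges and hence their
      heads, although \<open>w\<close> was queried before and \<open>v\<close> was not.\<close>
    have "card {v, x, y} = 3" "card {w, x, y} = 3"
      using V vxy w unfolding three_uniform_hypergraph_def by auto
    then have ne: "x \<noteq> y" "v \<notin> {x, y}" "w \<notin> {x, y}"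
      by (auto simp: card_insert_if split: if_splits)
    have "x \<in> V" "y \<in> V" using xy RvA A by auto
    then have "\<exists>\<^sub>\<le>\<^sub>1 e. e \<in> E \<and> x \<in> e \<and> y \<in> e \<and> f e \<notin> {x, y}"
      using f ne unfolding rooting_function_def by blast
    then have "{v, x, y} = {w, x, y}"
      using vxy w ne unfolding Uniq_def by (metis insertI1 insert_commute)
    then have "v = w" using vxy w by metis
    then show False using v w by auto
  qed
  then have "card (R \<union> Rv) = card R + card Rv" using finR finRv by (rule card_Un_disjoint[rotated 2])
  then have card: "real (Suc j) * t \<le> real (card (R \<union> Rv))"
    using st Rv(4) unfolding query_state_def by (simp add: algebra_simps)
  have deg: "real (card ((R \<union> Rv) `` {x})) \<le> 2 * s" for x
  proof (cases "x \<in> A - saturated A R s")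
    case True
    then have "real (card (R `` {x})) \<le> s" unfolding saturated_def by auto
    moreover have "(R \<union> Rv) `` {x} = R `` {x} \<union> Rv `` {x}" by auto
    then have "card ((R \<union> Rv) `` {x}) \<le> card (R `` {x}) + card (Rv `` {x})"
      by (metis card_Un_le)
    ultimately show ?thesis using Rv(3)[of x] by linarith
  next
    case False
    then have "(R \<union> Rv) `` {x} = R `` {x}" using Rv(1) by auto
    then show ?thesis using st unfolding query_state_def by auto
  qed
  have "card (insert v P) \<le> Suc j + card D"
    using st v finP unfolding query_state_def by simp
  moreover have "sym (R \<union> Rv)" using st Rv(2) unfolding query_state_def by (simp add: sym_Un)
  moreover have "\<forall>(x, y)\<in>R \<union> Rv. \<exists>w\<in>insert v P. {w, x, y} \<in> E \<and> f {w, x, y} = w"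
    using st Rv(5) unfolding query_state_def by fast
  ultimately show ?thesis
    using st v card deg RvA unfolding query_state_def by auto
qed

text \<open>A leaf of the first decision tree. Only \<open>D\<close> and \<open>R\<close> are passed
  on to the container algorithm; \<open>K\<close> is the size from which niceness would supply
  another query.\<close>

definition final_state ::
    "'a set set \<Rightarrow> ('a set \<Rightarrow> 'a) \<Rightarrow> 'a set \<Rightarrow> real \<Rightarrow> real \<Rightarrow> real \<Rightarrow> 'a set \<times> ('a \<times> 'a) set \<Rightarrow> bool" where
  "final_state E f A s t K = (\<lambda>(D, R).
     \<exists>P j. query_state E f A s t P D j R \<and> real (card (A - P - saturated A R s)) < K)"

text \<open>Negative answers are remembered by \<open>D\<close>, positive ones through their
  consequence that \<open>I\<close> is independent in \<open>R\<close>.\<close>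

definition compatible :: "'a set \<Rightarrow> 'a set \<times> ('a \<times> 'a) set \<Rightarrow> bool" where
  "compatible I = (\<lambda>(D, R). I \<inter> D = {} \<and> rel_independent R I)"

text \<open>Induction on the bound \<open>m\<close> for the unqueried vertices. The inequality for
  \<open>k\<close> is invariant, since a positive answer raises \<open>j\<close> and lowers
  \<open>k\<close> by one.\<close>

lemma query_eligible:
  assumes V: "three_uniform_hypergraph V E" and f: "rooting_function V E f"
    and A: "A \<subseteq> V" and s: "0 < s"
    and K: "\<And>A'. A' \<subseteq> V \<Longrightarrow> K \<le> real (card A') \<Longrightarrow> \<exists>v\<in>A'. eligible E f A' s t v"
    and st: "query_state E f A s t P D j R"
    and m: "card (A - P) \<le> m"
    and k: "2 * s * real (card A) < (real j + real k + 1) * t"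
  shows "\<exists>F. finite F \<and> card F \<le> binomial_sum m k \<and> (\<forall>S\<in>F. final_state E f A s t K S) \<and>
           (\<forall>I\<subseteq>A. independent_set V E I \<longrightarrow> compatible I (D, R) \<longrightarrow> (\<exists>S\<in>F. compatible I S))"
proof -
  have fin: "finite A" using V A finite_subset unfolding three_uniform_hypergraph_def by blast
  let ?ex = "\<lambda>m k D R. \<exists>F. finite F \<and> card F \<le> binomial_sum m k \<and>
           (\<forall>S\<in>F. final_state E f A s t K S) \<and>
           (\<forall>I\<subseteq>A. independent_set V E I \<longrightarrow> compatible I (D, R) \<longrightarrow> (\<exists>S\<in>F. compatible I S))"
  have stop: "?ex m k D R"
    if "query_state E f A s t P D j R" "real (card (A - P - saturated A R s)) < K"
    for P D j R m k
  proof -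
    have "final_state E f A s t K (D, R)" using that unfolding final_state_def by auto
    then show ?thesis using binomial_sum_pos by (intro exI[of _ "{(D, R)}"]) auto
  qed
  have pick: "\<exists>v\<in>A - P - saturated A R s. eligible E f (A - P - saturated A R s) s t v"
    if "\<not> real (card (A - P - saturated A R s)) < K" for P R
    using that A by (intro K) auto
  show ?thesis using st m k
  proof (induction m arbitrary: P D j R k)
    case 0
    then have "A - P = {}" using fin by simp
    \<comment> \<open>Otherwise \<open>pick\<close> would yield an element of the empty set.\<close>
    then have "real (card (A - P - saturated A R s)) < K" using pick[of P R] by blast
    then show ?case using stop 0(1) by blast
  next
    case (Suc m)
    show ?case
    proof (cases "real (card (A - P - saturated A R s)) < K")
      case True
      then show ?thesis using stop Suc.prems(1) by blast
    next
      case False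
      then obtain v where v: "v \<in> A - P - saturated A R s"
        and el: "eligible E f (A - P - saturated A R s) s t v"
        using pick by blast
      have sub: "A - P - saturated A R s \<subseteq> V" using A by auto
      obtain Rv where Rv:
        "Rv \<subseteq> (A - P - saturated A R s) \<times> (A - P - saturated A R s)" "sym Rv"
        "\<And>x. real (card (Rv `` {x})) \<le> s" "real (card Rv) \<ge> t"
        "\<And>x y. (x, y) \<in> Rv \<Longrightarrow> {v, x, y} \<in> E \<and> f {v, x, y} = v"
        using eligible_imp_rel[OF V sub el s] by metis
      have vAP: "v \<in> A - P" using v by auto
      have no: "query_state E f A s t (insert v P) (insert v D) j R"
        by (rule query_state_no[OF fin Suc.prems(1) vAP])
      have yes: "query_state E f A s t (insert v P) D (Suc j) (R \<union> Rv)"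
        by (rule query_state_yes[OF V f A fin Suc.prems(1) vAP s Rv])
      have "real (Suc j) * t \<le> 2 * s * real (card A)"
        by (rule query_state_positive_bound[OF fin yes])
      \<comment> \<open>With \<open>k = 0\<close> the positive branch would already exceed the
        degree-sum bound on positive answers.\<close>
      with Suc.prems(3) have "k \<noteq> 0" by (intro notI) (simp add: add.commute)
      then obtain l where l: "k = Suc l" by (cases k) auto
      have "A - insert v P = (A - P) - {v}" by auto
      then have m: "card (A - insert v P) \<le> m" using Suc.prems(2) vAP by simp
      obtain F1 where F1: "finite F1" "card F1 \<le> binomial_sum m k"
        "\<forall>S\<in>F1. final_state E f A s t K S"
        "\<forall>I\<subseteq>A. independent_set V E I \<longrightarrow> compatible I (insert v D, R) \<longrightarrow> (\<exists>S\<in>F1. compatible I S)"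
        using Suc.IH[OF no m Suc.prems(3)] by blast
      have "2 * s * real (card A) < (real (Suc j) + real l + 1) * t"
        using Suc.prems(3) l by (simp add: algebra_simps)
      then obtain F2 where F2: "finite F2" "card F2 \<le> binomial_sum m l"
        "\<forall>S\<in>F2. final_state E f A s t K S"
        "\<forall>I\<subseteq>A. independent_set V E I \<longrightarrow> compatible I (D, R \<union> Rv) \<longrightarrow> (\<exists>S\<in>F2. compatible I S)"
        using Suc.IH[OF yes m] by blast
      have "card (F1 \<union> F2) \<le> binomial_sum (Suc m) k"
        using card_Un_le[of F1 F2] F1(2) F2(2) by (simp add: l binomial_sum_Suc_Suc)
      moreover have "\<exists>S\<in>F1 \<union> F2. compatible I S"
        if I: "I \<subseteq> A" "independent_set V E I" "compatible I (D, R)" for I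
      proof (cases "v \<in> I")
        case True
        have "rel_independent Rv I"
        proof -
          \<comment> \<open>A pair of \<open>Rv\<close> inside \<open>I\<close> would, together with
            \<open>v\<close>, form an edge of \<open>E\<close> inside \<open>I\<close>.\<close>
          have "\<not> (x \<in> I \<and> y \<in> I)" if "(x, y) \<in> Rv" for x y
            using Rv(5)[OF that] I(2) True unfolding independent_set_def by auto
          then show ?thesis unfolding rel_independent_def by auto
        qed
        then have "compatible I (D, R \<union> Rv)"
          using I(3) unfolding compatible_def rel_independent_def by auto
        then show ?thesis using F2(4) I by blast
      next
        case False
        then have "compatible I (insert v D, R)" using I(3) unfolding compatible_def by auto
        then show ?thesis using F1(4) I by blast
      qed
      ultimately show ?thesis using F1(1,3) F2(1,3) by (intro exI[of _ "F1 \<union> F2"]) blast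
    qed
  qed
qed

section \<open>One round\<close>

text \<open>\<open>R\<close> is counted twice: from below through the saturated vertices, from above
  by separating the pairs meeting \<open>A - C\<close> from those inside \<open>C\<close>.\<close>

lemma final_state_shrink:
  assumes eps: "0 < \<epsilon>" "\<epsilon> \<le> 1/10" and s: "0 < s" and t: "8 * s \<le> \<epsilon> * t"
    and fin: "finite A" and large: "(1 + 100 * \<epsilon>) * N < real (card A)" and N: "0 < N"
    and final: "final_state E f A s t ((1 + \<epsilon>) * N) (D, R)"
    and C: "C \<subseteq> A - D" "\<And>u. u \<in> C \<Longrightarrow> real (card (R `` {u} \<inter> C)) < 4 * \<epsilon> * s"
  shows "real (card C) \<le> (1 - \<epsilon> / 2) * real (card A)"
proof (rule ccontr)
  assume contr: "\<not> ?thesis"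
  define n where "n = real (card A)"
  define X where "X = A - C"
  define B where "B = saturated A R s"
  obtain P j where st: "query_state E f A s t P D j R"
    and few: "real (card (A - P - B)) < (1 + \<epsilon>) * N"
    using final unfolding final_state_def B_def by auto
  have n0: "0 < n"
  proof -
    have "0 < (1 + 100 * \<epsilon>) * N" using N eps by (intro mult_pos_pos) auto
    then show ?thesis using large n_def by linarith
  qed
  have CA: "C \<subseteq> A" and BA: "B \<subseteq> A" and PA: "P \<subseteq> A" and DX: "D \<subseteq> X" and RA: "R \<subseteq> A \<times> A"
    using C(1) st unfolding query_state_def B_def saturated_def X_def by auto
  have finC: "finite C" and finB: "finite B" and finP: "finite P" and finX: "finite X"
    using fin CA BA PA finite_subset unfolding X_def by auto
  have finR: "finite R" using RA fin finite_subset by blast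
  have "real (card X) = n - real (card C)"
    unfolding X_def n_def using fin finC CA by (simp add: card_Diff_subset card_mono of_nat_diff)
  then have X: "real (card X) < \<epsilon> * n / 2" using contr n_def by (simp add: algebra_simps)
  have "card D \<le> card X" using DX finX by (rule card_mono[rotated])
  then have D: "real (card D) < \<epsilon> * n / 2" using X by linarith
  have "real j * t \<le> 2 * s * n"
    using query_state_positive_bound[OF fin st] n_def by simp
  moreover have "2 * s * n \<le> (\<epsilon> * n / 4) * t"
    using mult_right_mono[OF t, of n] n0 by (simp add: algebra_simps)
  ultimately have "real j * t \<le> (\<epsilon> * n / 4) * t" by linarith
  moreover have "0 < t" using t s eps by (smt (verit) mult_nonneg_nonpos)
  ultimately have j: "real j \<le> \<epsilon> * n / 4" by simp
  have cover: "n \<le> real (card (A - P - B)) + real (card P) + real (card B)"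
  proof -
    have "A \<subseteq> (A - P - B) \<union> (P \<union> B)" by auto
    then have "card A \<le> card ((A - P - B) \<union> (P \<union> B))" using fin finP finB by (intro card_mono) auto
    also have "\<dots> \<le> card (A - P - B) + card (P \<union> B)" by (rule card_Un_le)
    also have "\<dots> \<le> card (A - P - B) + (card P + card B)" using card_Un_le by (simp add: card_Un_le)
    finally show ?thesis unfolding n_def by linarith
  qed
  have P: "real (card P) \<le> real j + real (card D)" using st unfolding query_state_def by linarith
  \<comment> \<open>The product \<open>(1 - 9 * \<epsilon>) * (1 + 100 * \<epsilon>)\<close> exceeds
    \<open>1 + \<epsilon>\<close> by \<open>90 * \<epsilon> - 900 * \<epsilon>^2\<close>, which is
    nonnegative exactly because \<open>\<epsilon> \<le> 1/10\<close>.\<close>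
  have KN: "(1 + \<epsilon>) * N \<le> (1 - 9 * \<epsilon>) * n"
  proof -
    have "\<epsilon> * \<epsilon> \<le> \<epsilon> * (1/10)" using eps by (intro mult_left_mono) auto
    then have "1 + \<epsilon> \<le> (1 - 9 * \<epsilon>) * (1 + 100 * \<epsilon>)" by (simp add: algebra_simps)
    then have "(1 + \<epsilon>) * N \<le> (1 - 9 * \<epsilon>) * ((1 + 100 * \<epsilon>) * N)"
      using mult_right_mono N by (metis less_imp_le mult.assoc)
    also have "\<dots> \<le> (1 - 9 * \<epsilon>) * n"
      using large eps n_def by (intro mult_left_mono) auto
    finally show ?thesis .
  qed
  \<comment> \<open>Of the \<open>9 * \<epsilon> * n\<close> vertices missing from the unqueried
    unsaturated set, fewer than \<open>3/4 * \<epsilon> * n\<close> were queried: at most a quarter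
    positively, less than a half negatively.\<close>
  have B8: "8 * (\<epsilon> * n) < real (card B)"
    using cover P few KN j D eps n0 mult_pos_pos[of \<epsilon> n] by (simp add: algebra_simps)
  have Rlow: "real (card B) * s \<le> real (card R)"
  proof -
    have "real (card B) * s \<le> (\<Sum>x\<in>B. real (card (R `` {x})))"
      using sum_bounded_below[of B s "\<lambda>x. real (card (R `` {x}))"]
      unfolding B_def saturated_def by auto
    also have "\<dots> \<le> (\<Sum>x\<in>A. real (card (R `` {x})))" using fin BA by (intro sum_mono2) auto
    finally show ?thesis using card_rel_eq_sum[OF fin RA] by simp
  qed
  define R1 where "R1 = R \<inter> X \<times> A"
  define R2 where "R2 = R \<inter> C \<times> C"
  have deg: "real (card (R `` {x})) \<le> 2 * s" for x using st unfolding query_state_def by auto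
  have finRx: "finite (R `` {x})" for x using finR by (rule finite_Image)
  have R1: "real (card R1) \<le> real (card X) * (2 * s)"
  proof -
    have R1x: "real (card (R1 `` {x})) \<le> (if x \<in> X then 2 * s else 0)" for x
    proof (cases "x \<in> X")
      case True
      have "R1 `` {x} \<subseteq> R `` {x}" unfolding R1_def by auto
      then have "card (R1 `` {x}) \<le> card (R `` {x})" using finRx by (intro card_mono) auto
      then show ?thesis using True deg[of x] by auto
    next
      case False
      then have "R1 `` {x} = {}" unfolding R1_def by auto
      then show ?thesis using False by simp
    qed
    have "R1 \<subseteq> A \<times> A" using RA unfolding R1_def by auto
    then have "real (card R1) = (\<Sum>x\<in>A. real (card (R1 `` {x})))"
      using card_rel_eq_sum[OF fin] by simp
    also have "\<dots> \<le> (\<Sum>x\<in>A. if x \<in> X then 2 * s else 0)" using R1x by (intro sum_mono)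
    also have "\<dots> = (\<Sum>x\<in>X. 2 * s)"
      using fin by (intro sum.mono_neutral_cong_right) (auto simp: X_def)
    finally show ?thesis by simp
  qed
  have R2: "real (card R2) \<le> real (card C) * (4 * \<epsilon> * s)"
  proof (rule card_rel_le[OF finC])
    fix x assume x: "x \<in> C"
    then have "R2 `` {x} = R `` {x} \<inter> C" unfolding R2_def by auto
    then show "real (card (R2 `` {x})) \<le> 4 * \<epsilon> * s" using C(2)[OF x] by simp
  qed (auto simp: R2_def)
  have finR12: "finite R1" "finite R2" using finR unfolding R1_def R2_def by auto
  \<comment> \<open>By symmetry the pairs whose second entry lies in \<open>X\<close> are the
    converse of \<open>R1\<close>.\<close>
  have "R \<subseteq> (R1 \<union> R1\<inverse>) \<union> R2"
    using RA st unfolding query_state_def R1_def R2_def X_def sym_def by auto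
  then have "card R \<le> card ((R1 \<union> R1\<inverse>) \<union> R2)" using finR12 by (intro card_mono) auto
  also have "\<dots> \<le> card (R1 \<union> R1\<inverse>) + card R2" by (rule card_Un_le)
  also have "card (R1 \<union> R1\<inverse>) \<le> card R1 + card (R1\<inverse>)" by (rule card_Un_le)
  finally have "card R \<le> 2 * card R1 + card R2" by simp
  then have "real (card R) \<le> 2 * real (card R1) + real (card R2)" by linarith
  moreover have "real (card X) * (2 * s) \<le> (\<epsilon> * n / 2) * (2 * s)"
    using X s by (intro mult_right_mono) auto
  moreover have "real (card C) * (4 * \<epsilon> * s) \<le> n * (4 * \<epsilon> * s)"
    using fin CA eps s unfolding n_def by (intro mult_right_mono) (auto simp: card_mono)
  \<comment> \<open>\<open>R1\<close>, counted twice, contributes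
    \<open>2 * \<epsilon> * n * s\<close> and \<open>R2\<close> contributes
    \<open>4 * \<epsilon> * n * s\<close>.\<close>
  ultimately have "real (card R) \<le> 6 * (\<epsilon> * n) * s" using R1 R2 by (simp add: algebra_simps)
  moreover have "8 * (\<epsilon> * n) * s < real (card B) * s" using B8 s by simp
  moreover have "0 < \<epsilon> * n * s" using eps n0 s by simp
  ultimately show False using Rlow by linarith
qed

text \<open>The container algorithm is run on \<open>A - D\<close> at every leaf
  \<open>(D, R)\<close> of the first tree, so the leaf counts multiply and the entropies
  add.\<close>

lemma one_round:
  assumes V: "three_uniform_hypergraph V E" and f: "rooting_function V E f"
    and nice: "nice V E f \<epsilon> N s t" and A: "A \<subseteq> V"
    and eps: "0 < \<epsilon>" "\<epsilon> \<le> 1/10" and t: "8 * s \<le> \<epsilon> * t" and s: "1 / \<epsilon>^2 \<le> s" and N: "0 < N"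
    and large: "(1 + 100 * \<epsilon>) * N < real (card A)"
  shows "\<exists>F \<subseteq> Pow A. real (card F) \<le> 2 powr (real (card A) *
             (binary_entropy (2 * s / t) + binary_entropy (1 / (4 * \<epsilon> * s)))) \<and>
           (\<forall>C\<in>F. real (card C) \<le> (1 - \<epsilon> / 2) * real (card A)) \<and>
           (\<forall>I\<subseteq>A. independent_set V E I \<longrightarrow> (\<exists>C\<in>F. I \<subseteq> C))"
proof -
  define n where "n = card A"
  define d where "d = 4 * \<epsilon> * s"
  have fin: "finite A" using V A finite_subset unfolding three_uniform_hypergraph_def by blast
  have s0: "0 < s" using s eps by (smt (verit) divide_pos_pos zero_less_power)
  have t0: "0 < t" using t s0 eps by (smt (verit) mult_nonneg_nonpos)
  have d0: "0 < d" unfolding d_def using eps s0 by simp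
  \<comment> \<open>This leads to \<open>1 / d \<le> 1/2\<close>, as the entropy bound
    demands.\<close>
  have "4 \<le> 4 * s * \<epsilon>^2" using s eps by (simp add: field_simps)
  also have "\<dots> = d * \<epsilon>" by (simp add: d_def power2_eq_square)
  also have "\<dots> \<le> d * (1/10)" using eps d0 by (intro mult_left_mono) auto
  finally have d2: "2 \<le> d" by simp
  \<comment> \<open>Rounding down serves both sides: \<open>k \<le> p * n\<close> for the entropy
    bound and \<open>p * n < k + 1\<close> for the strict budget conditions of the two
    trees.\<close>
  define k1 where "k1 = nat \<lfloor>2 * s / t * real n\<rfloor>"
  define k2 where "k2 = nat \<lfloor>1 / d * real n\<rfloor>"
  have k1: "real k1 \<le> 2 * s / t * real n" "2 * s / t * real n < real k1 + 1"
    unfolding k1_def using s0 t0 by (auto simp: of_nat_nat)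
  have k2: "real k2 \<le> 1 / d * real n" "1 / d * real n < real k2 + 1"
    unfolding k2_def using d0 by (auto simp: of_nat_nat)
  have bound1: "real (binomial_sum n k1) \<le> 2 powr (real n * binary_entropy (2 * s / t))"
  proof (rule binomial_sum_le_entropy)
    have "\<epsilon> * t \<le> 1 * t" using eps t0 by (intro mult_right_mono) auto
    then have "8 * s \<le> t" using t by linarith
    then show "2 * s / t \<le> 1 / 2" using t0 s0 by (simp add: field_simps)
  qed (use k1 s0 t0 in auto)
  have bound2: "real (binomial_sum n k2) \<le> 2 powr (real n * binary_entropy (1 / d))"
    by (rule binomial_sum_le_entropy) (use k2 d2 in auto)
  have start: "query_state E f A s t {} {} 0 {}"
    unfolding query_state_def sym_def using s0 by auto
  have K: "\<exists>v\<in>A'. eligible E f A' s t v" if "A' \<subseteq> V" "(1 + \<epsilon>) * N \<le> real (card A')" for A'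
    using nice that unfolding nice_def by blast
  have "2 * s * real (card A) < (real 0 + real k1 + 1) * t"
    using k1(2) t0 unfolding n_def by (simp add: field_simps)
  then obtain S where S: "finite S" "card S \<le> binomial_sum n k1"
    "\<forall>x\<in>S. final_state E f A s t ((1 + \<epsilon>) * N) x"
    "\<forall>I\<subseteq>A. independent_set V E I \<longrightarrow> compatible I ({}, {}) \<longrightarrow> (\<exists>x\<in>S. compatible I x)"
    using query_eligible[OF V f A s0 _ start, where m = n and k = k1 and K = "(1 + \<epsilon>) * N"] K unfolding n_def by auto
  have "\<exists>F. F \<subseteq> Pow (A - D) \<and> card F \<le> binomial_sum n k2 \<and>
           (\<forall>C\<in>F. \<forall>u\<in>C. real (card (R `` {u} \<inter> C)) < d) \<and>
           (\<forall>I\<subseteq>A - D. rel_independent R I \<longrightarrow> (\<exists>C\<in>F. I \<subseteq> C))" for D and R :: "('a \<times> 'a) set"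
  proof (rule graph_containers[OF d0])
    show "card {u \<in> A - D. d \<le> real (card (R `` {u} \<inter> (A - D)))} \<le> n"
      unfolding n_def using fin by (intro card_mono) auto
    have "real (card (A - D)) \<le> real n" unfolding n_def using fin by (simp add: card_mono)
    also have "\<dots> < (real k2 + 1) * d" using k2(2) d0 by (simp add: field_simps)
    finally show "real (card (A - D)) < (real k2 + 1) * d" .
  qed (use fin in auto)
  then obtain G where G: "\<And>D R. G D R \<subseteq> Pow (A - D)" "\<And>D R. card (G D R) \<le> binomial_sum n k2"
    "\<And>D R C u. C \<in> G D R \<Longrightarrow> u \<in> C \<Longrightarrow> real (card (R `` {u} \<inter> C)) < d"
    "\<And>D R I. I \<subseteq> A - D \<Longrightarrow> rel_independent R I \<Longrightarrow> \<exists>C\<in>G D R. I \<subseteq> C"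
    by metis
  define F where "F = (\<Union>(D, R)\<in>S. G D R)"
  have "F \<subseteq> Pow A" using G(1) unfolding F_def by fastforce
  moreover have "real (card F) \<le> 2 powr (real n * (binary_entropy (2 * s / t) + binary_entropy (1 / d)))"
  proof -
    have "card F \<le> (\<Sum>x\<in>S. card (case x of (D, R) \<Rightarrow> G D R))"
      unfolding F_def by (rule card_UN_le[OF S(1)])
    also have "\<dots> \<le> (\<Sum>x\<in>S. binomial_sum n k2)" using G(2) by (intro sum_mono) auto
    also have "\<dots> \<le> binomial_sum n k1 * binomial_sum n k2" using S(2) by simp
    finally have "real (card F) \<le> real (binomial_sum n k1) * real (binomial_sum n k2)"
      by (metis of_nat_le_iff of_nat_mult)
    also have "\<dots> \<le> 2 powr (real n * binary_entropy (2 * s / t)) * 2 powr (real n * binary_entropy (1 / d))"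
      using bound1 bound2 by (intro mult_mono) auto
    finally show ?thesis by (simp add: powr_add distrib_left)
  qed
  moreover have "real (card C) \<le> (1 - \<epsilon> / 2) * real (card A)" if C: "C \<in> F" for C
  proof -
    obtain D R where DR: "(D, R) \<in> S" "C \<in> G D R" using C unfolding F_def by blast
    then have "final_state E f A s t ((1 + \<epsilon>) * N) (D, R)" using S(3) by blast
    then show ?thesis
      using G(1) G(3)[OF DR(2)] DR(2)
      by (intro final_state_shrink[OF eps s0 t fin large N, of E f D R C]) (auto simp: d_def)
  qed
  moreover have "\<exists>C\<in>F. I \<subseteq> C" if I: "I \<subseteq> A" "independent_set V E I" for I
  proof -
    have "compatible I ({}, {})" unfolding compatible_def rel_independent_def by auto
    then obtain x where "x \<in> S" "compatible I x" using S(4) I by blast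
    then obtain D R where DR: "(D, R) \<in> S" "compatible I (D, R)" by (cases x) auto
    then have "I \<subseteq> A - D" "rel_independent R I" using I unfolding compatible_def by auto
    then obtain C where "C \<in> G D R" "I \<subseteq> C" using G(4) by blast
    then show ?thesis using DR unfolding F_def by blast
  qed
  ultimately show ?thesis unfolding n_def d_def by (intro exI[of _ F]) auto
qed

section \<open>Iterating the rounds\<close>

text \<open>Strong induction on \<open>card A\<close>. The exponent
  \<open>2 * n / \<epsilon> * h\<close> is the fixed point of the recurrence that adds
  \<open>n * h\<close> per round and shrinks \<open>n\<close> by the factor
  \<open>1 - \<epsilon> / 2\<close>.\<close>

lemma iterate_containers:
  fixes h \<epsilon> K :: real
  assumes eps: "0 < \<epsilon>" "\<epsilon> \<le> 1" and h: "0 \<le> h" and K: "0 \<le> K" and V: "finite V"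
    and round: "\<And>A. A \<subseteq> V \<Longrightarrow> K < real (card A) \<Longrightarrow>
      \<exists>F \<subseteq> Pow A. real (card F) \<le> 2 powr (real (card A) * h) \<and>
           (\<forall>C\<in>F. real (card C) \<le> (1 - \<epsilon> / 2) * real (card A)) \<and>
           (\<forall>I\<subseteq>A. Q I \<longrightarrow> (\<exists>C\<in>F. I \<subseteq> C))"
    and A: "A \<subseteq> V"
  shows "\<exists>F \<subseteq> Pow A. real (card F) \<le> 2 powr (2 * real (card A) / \<epsilon> * h) \<and>
           (\<forall>C\<in>F. real (card C) \<le> K) \<and> (\<forall>I\<subseteq>A. Q I \<longrightarrow> (\<exists>C\<in>F. I \<subseteq> C))"
  using A
proof (induction "card A" arbitrary: A rule: less_induct)
  case less
  show ?case
  proof (cases "K < real (card A)")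
    case False
    have "0 \<le> 2 * real (card A) / \<epsilon> * h" using eps h by simp
    then have "1 \<le> 2 powr (2 * real (card A) / \<epsilon> * h)" by (simp add: ge_one_powr_ge_zero)
    then show ?thesis using False by (intro exI[of _ "{A}"]) auto
  next
    case True
    define n where "n = real (card A)"
    have finA: "finite A" using less.prems V finite_subset by blast
    obtain F where F: "F \<subseteq> Pow A" "real (card F) \<le> 2 powr (n * h)"
      "\<forall>C\<in>F. real (card C) \<le> (1 - \<epsilon> / 2) * n"
      "\<forall>I\<subseteq>A. Q I \<longrightarrow> (\<exists>C\<in>F. I \<subseteq> C)"
      using round[OF less.prems True] unfolding n_def by blast
    have finF: "finite F" using F(1) finA by (meson finite_Pow_iff finite_subset)
    define b where "b = 2 powr (2 * ((1 - \<epsilon> / 2) * n) / \<epsilon> * h)"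
    have "\<exists>G \<subseteq> Pow C. real (card G) \<le> b \<and> (\<forall>C'\<in>G. real (card C') \<le> K) \<and>
        (\<forall>I\<subseteq>C. Q I \<longrightarrow> (\<exists>C'\<in>G. I \<subseteq> C'))" if C: "C \<in> F" for C
    proof -
      have le: "real (card C) \<le> (1 - \<epsilon> / 2) * n" using F(3) C by blast
      \<comment> \<open>Strictness needs \<open>n > 0\<close>, which follows from
        \<open>0 \<le> K < n\<close>.\<close>
      have "(1 - \<epsilon> / 2) * n < n" using True K eps unfolding n_def by (simp add: algebra_simps)
      then have "card C < card A" using le unfolding n_def by linarith
      moreover have "C \<subseteq> V" using C F(1) less.prems by auto
      ultimately obtain G where G: "G \<subseteq> Pow C" "real (card G) \<le> 2 powr (2 * real (card C) / \<epsilon> * h)"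
        "\<forall>C'\<in>G. real (card C') \<le> K" "\<forall>I\<subseteq>C. Q I \<longrightarrow> (\<exists>C'\<in>G. I \<subseteq> C')"
        using less.hyps by metis
      have "2 powr (2 * real (card C) / \<epsilon> * h) \<le> b"
        unfolding b_def using le eps h
        by (intro powr_mono mult_right_mono divide_right_mono mult_left_mono) auto
      then show ?thesis using G by (meson order_trans)
    qed
    then obtain G where G: "\<And>C. C \<in> F \<Longrightarrow> G C \<subseteq> Pow C" "\<And>C. C \<in> F \<Longrightarrow> real (card (G C)) \<le> b"
      "\<And>C C'. C \<in> F \<Longrightarrow> C' \<in> G C \<Longrightarrow> real (card C') \<le> K"
      "\<And>C I. C \<in> F \<Longrightarrow> I \<subseteq> C \<Longrightarrow> Q I \<Longrightarrow> \<exists>C'\<in>G C. I \<subseteq> C'"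
      by metis
    define H where "H = (\<Union>C\<in>F. G C)"
    have "real (card H) \<le> 2 powr (2 * n / \<epsilon> * h)"
    proof -
      have "card H \<le> (\<Sum>C\<in>F. card (G C))" unfolding H_def by (rule card_UN_le[OF finF])
      then have "real (card H) \<le> (\<Sum>C\<in>F. real (card (G C)))" by (simp flip: of_nat_sum)
      also have "\<dots> \<le> real (card F) * b" using G(2) by (rule sum_bounded_above)
      also have "\<dots> \<le> 2 powr (n * h) * b" using F(2) by (intro mult_right_mono) (auto simp: b_def)
      also have "\<dots> = 2 powr (n * h + 2 * ((1 - \<epsilon> / 2) * n) / \<epsilon> * h)" by (simp add: b_def powr_add)
      also have "n * h + 2 * ((1 - \<epsilon> / 2) * n) / \<epsilon> * h = 2 * n / \<epsilon> * h"
        using eps by (simp add: field_simps)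
      finally show ?thesis .
    qed
    moreover have "H \<subseteq> Pow A" using F(1) G(1) unfolding H_def by blast
    moreover have "\<exists>C\<in>H. I \<subseteq> C" if "I \<subseteq> A" "Q I" for I
      using F(4) G(4) that unfolding H_def by (metis UN_I)
    moreover have "\<forall>C\<in>H. real (card C) \<le> K" using G(3) unfolding H_def by auto
    ultimately show ?thesis unfolding n_def by (intro exI[of _ H]) auto
  qed
qed

lemma binary_entropy_nonneg:
  assumes "0 \<le> p" "p \<le> 1"
  shows "0 \<le> binary_entropy p"
proof -
  have "p * log 2 p \<le> 0" if "0 \<le> p" "p \<le> 1" for p :: real
    using that by (cases "p = 0") (auto intro: mult_nonneg_nonpos)
  from this[of p] this[of "1 - p"] show ?thesis using assms unfolding binary_entropy_def by simp
qed

theorem theorem4: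
  fixes V :: "'a set" and E :: "'a set set" and f :: "'a set \<Rightarrow> 'a"
    and \<epsilon> s t N :: real and M :: nat
  assumes "\<epsilon> > 0" and "s > 0" and "t > 0" and "N > 0" and "M > 0"
    and "\<epsilon> \<le> 1 / 10"
    and "8 * s \<le> \<epsilon> * t"
    and "1 / \<epsilon>^2 \<le> s"
    and "real M \<ge> (1 + 100 * \<epsilon>) * N"
    and "three_uniform_hypergraph V E"
    and "card V = M"
    and "rooting_function V E f"
    and "nice V E f \<epsilon> N s t"
  shows "\<exists>\<C> \<subseteq> Pow V.
           (\<forall>I. independent_set V E I \<longrightarrow> (\<exists>C\<in>\<C>. I \<subseteq> C)) \<and>
           log 2 (real (card \<C>)) \<le>
             2 * real M / \<epsilon> * (binary_entropy (2 * s / t) + binary_entropy (1 / (4 * \<epsilon> * s))) \<and>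
           (\<forall>C\<in>\<C>. real (card C) \<le> (1 + 100 * \<epsilon>) * N)"
proof -
  let ?h = "binary_entropy (2 * s / t) + binary_entropy (1 / (4 * \<epsilon> * s))"
  let ?K = "(1 + 100 * \<epsilon>) * N"
  have V: "finite V" using assms unfolding three_uniform_hypergraph_def by blast
  have "\<epsilon> * t \<le> 1 * t" using assms by (intro mult_right_mono) auto
  then have "2 * s \<le> t" using assms(2,7) by linarith
  then have p1: "2 * s / t \<le> 1" using assms(3) by simp
  have "4 \<le> 4 * \<epsilon> * s * \<epsilon>" using assms by (simp add: field_simps power2_eq_square)
  also have "\<dots> \<le> 4 * \<epsilon> * s * 1" using assms by (intro mult_left_mono) auto
  finally have p2: "1 / (4 * \<epsilon> * s) \<le> 1" by simp
  \<comment> \<open>Nonnegativity makes the exponent monotone in the set size and lets a single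
    container meet the bound.\<close>
  have h: "0 \<le> ?h"
    using p1 p2 assms by (intro add_nonneg_nonneg binary_entropy_nonneg) auto
  have "\<exists>F \<subseteq> Pow V. real (card F) \<le> 2 powr (2 * real (card V) / \<epsilon> * ?h) \<and>
           (\<forall>C\<in>F. real (card C) \<le> ?K) \<and> (\<forall>I\<subseteq>V. independent_set V E I \<longrightarrow> (\<exists>C\<in>F. I \<subseteq> C))"
    using assms h V by (intro iterate_containers one_round) auto
  then obtain F where F: "F \<subseteq> Pow V" "real (card F) \<le> 2 powr (2 * real M / \<epsilon> * ?h)"
    "\<forall>C\<in>F. real (card C) \<le> ?K" "\<forall>I\<subseteq>V. independent_set V E I \<longrightarrow> (\<exists>C\<in>F. I \<subseteq> C)"
    using assms by blast
  have cover: "\<forall>I. independent_set V E I \<longrightarrow> (\<exists>C\<in>F. I \<subseteq> C)"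
    using F(4) unfolding independent_set_def by auto
  \<comment> \<open>Covering the empty set forces a nonempty family, so the logarithm is taken of a
    positive number.\<close>
  have "independent_set V E {}"
    using assms unfolding independent_set_def three_uniform_hypergraph_def by auto
  then have "F \<noteq> {}" using cover by blast
  moreover have "finite F" using F(1) V by (meson finite_Pow_iff finite_subset)
  ultimately have "0 < card F" by (simp add: card_gt_0_iff)
  then have "log 2 (real (card F)) \<le> 2 * real M / \<epsilon> * ?h"
    using F(2) by (simp add: log_le_iff)
  then show ?thesis using F(1,3) cover by (intro exI[of _ F]) auto
qed

end
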